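(* Let $(x_i)_{i=0}^\infty$ be a sequence of real numbers and for $n\ge 0$ let $$\mu_n:=\frac1{n+1}\sum_{i=0}^n x_i,\qquad \sigma_n^2:=\frac1{n+1}\sum_{i=0}^n (x_i-\mu_n)^2.$$ Assume $\sup_{n\ge0}\sigma_n^2\le C<\infty$ for some constant $C$. Then $$n!\,\exp[x_0,\dots,x_n]=\exp\!\left(\mu_n+\frac{\sigma_n^2}{2n}+O\big(n^{-3/2}\big)\right)\qquad\text{as } n\to\infty.$$
   Context: $\exp[z_0,\dots,z_m]$ (square brackets) denotes the divided difference of the function $e^x$ at the nodes $z_0,\dots,z_m$. It is symmetric in the nodes; for pairwise distinct nodes it equals $\sum_{i=0}^m e^{z_i}/\prod_{j\ne i}(z_i-z_j)$, and for repeated nodes it is defined by continuous extension, equivalently by the contour integral $\frac{1}{2\pi i}\oint_\Gamma \frac{e^z}{\prod_{i=0}^m (z-z_i)}\,dz$ with $\Gamma$ a positively oriented contour enclosing all nodes. On the right-hand side, $\exp(\cdot)$ with round brackets is the ordinary exponential function. *)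

theory Defs
  imports "HOL-Complex_Analysis.Complex_Analysis" "HOL-Library.Landau_Symbols"
begin

text \<open>
  The divided difference \<open>exp[z 0, \<dots>, z m]\<close> is the contour integral of
  \<open>exp w / (\<Prod>i\<le>m. w - z i)\<close> over a contour enclosing all nodes, repeated or not; the circle
  below is one such contour. The lemmas that follow show that any other contour gives the same
  value, that the value for pairwise distinct nodes is the classical sum, that it depends
  continuously on the nodes (so that repeated nodes are covered by continuous extension), and
  that it is symmetric.
\<close>

definition exp_divdiff :: "(nat \<Rightarrow> complex) \<Rightarrow> nat \<Rightarrow> complex" where
  "exp_divdiff z m =
     1 / (2 * of_real pi * \<i>) *
     contour_integral (circlepath 0 (1 + (\<Sum>i\<le>m. norm (z i)))) (\<lambda>w. exp w / (\<Prod>i\<le>m. w - z i))"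

lemma norm_node_less:
  fixes z :: "nat \<Rightarrow> complex"
  assumes "i \<le> m"
  shows "norm (z i) < 1 + (\<Sum>i\<le>m. norm (z i))"
proof -
  have "norm (z i) \<le> (\<Sum>i\<le>m. norm (z i))"
    using assms by (intro member_le_sum) auto
  then show ?thesis by simp
qed

lemma contour_integral_exp_divdiff_residues:
  fixes z :: "nat \<Rightarrow> complex"
  assumes "valid_path g" "pathfinish g = pathstart g"
    and "path_image g \<inter> z ` {..m} = {}"
    and wn: "\<And>i. i \<le> m \<Longrightarrow> winding_number g (z i) = 1"
  shows "contour_integral g (\<lambda>w. exp w / (\<Prod>i\<le>m. w - z i)) =
           2 * of_real pi * \<i> * (\<Sum>p\<in>z ` {..m}. residue (\<lambda>w. exp w / (\<Prod>i\<le>m. w - z i)) p)"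
proof -
  have "contour_integral g (\<lambda>w. exp w / (\<Prod>i\<le>m. w - z i)) =
          2 * pi * \<i> * (\<Sum>p\<in>z ` {..m}. winding_number g p *
            residue (\<lambda>w. exp w / (\<Prod>i\<le>m. w - z i)) p)"
  proof (rule Residue_theorem[where S = UNIV])
    show "(\<lambda>w. exp w / (\<Prod>i\<le>m. w - z i)) holomorphic_on UNIV - z ` {..m}"
      by (intro holomorphic_intros) auto
  qed (use assms in auto)
  also have "(\<Sum>p\<in>z ` {..m}. winding_number g p * residue (\<lambda>w. exp w / (\<Prod>i\<le>m. w - z i)) p) =
             (\<Sum>p\<in>z ` {..m}. residue (\<lambda>w. exp w / (\<Prod>i\<le>m. w - z i)) p)"
    using wn by (intro sum.cong) auto
  finally show ?thesis by simp
qed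

lemma exp_divdiff_residues:
  "exp_divdiff z m = (\<Sum>p\<in>z ` {..m}. residue (\<lambda>w. exp w / (\<Prod>i\<le>m. w - z i)) p)"
proof -
  define R where "R = 1 + (\<Sum>i\<le>m. norm (z i))"
  have less: "norm (z i) < R" if "i \<le> m" for i
    using norm_node_less[OF that] by (simp add: R_def)
  have "R > 0" using less[of 0] norm_ge_zero[of "z 0"] by linarith
  have "contour_integral (circlepath 0 R) (\<lambda>w. exp w / (\<Prod>i\<le>m. w - z i)) =
          2 * of_real pi * \<i> * (\<Sum>p\<in>z ` {..m}. residue (\<lambda>w. exp w / (\<Prod>i\<le>m. w - z i)) p)"
  proof (rule contour_integral_exp_divdiff_residues)
    show "path_image (circlepath 0 R) \<inter> z ` {..m} = {}"
      using \<open>R > 0\<close> less by fastforce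
    show "winding_number (circlepath 0 R) (z i) = 1" if "i \<le> m" for i
      using less[OF that] by (intro winding_number_circlepath) auto
  qed auto
  then show ?thesis by (simp add: exp_divdiff_def R_def)
qed

lemma exp_divdiff_contour:
  assumes "valid_path g" "pathfinish g = pathstart g"
    and "path_image g \<inter> z ` {..m} = {}"
    and "\<And>i. i \<le> m \<Longrightarrow> winding_number g (z i) = 1"
  shows "exp_divdiff z m =
           1 / (2 * of_real pi * \<i>) * contour_integral g (\<lambda>w. exp w / (\<Prod>i\<le>m. w - z i))"
  by (simp add: exp_divdiff_residues contour_integral_exp_divdiff_residues[OF assms])

lemma exp_divdiff_distinct:
  assumes "inj_on z {..m}"
  shows "exp_divdiff z m = (\<Sum>i\<le>m. exp (z i) / (\<Prod>j\<in>{..m} - {i}. z i - z j))"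
proof -
  have "residue (\<lambda>w. exp w / (\<Prod>j\<le>m. w - z j)) (z i) =
          exp (z i) / (\<Prod>j\<in>{..m} - {i}. z i - z j)" if i: "i \<le> m" for i
  proof -
    let ?h = "\<lambda>w. exp w / (\<Prod>j\<in>{..m} - {i}. w - z j)"
    let ?S = "- z ` ({..m} - {i})"
    have "residue (\<lambda>w. ?h w / (w - z i)) (z i) = ?h (z i)"
    proof (rule residue_simple)
      show "open ?S" by (intro open_Compl finite_imp_closed) auto
      show "z i \<in> ?S" using assms i by (auto simp: inj_on_def)
      show "?h holomorphic_on ?S" by (intro holomorphic_intros) auto
    qed
    moreover have "(\<Prod>j\<le>m. w - z j) = (\<Prod>j\<in>{..m} - {i}. w - z j) * (w - z i)" for w
      using i by (subst prod.remove[of _ i]) (auto simp: mult.commute)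
    ultimately show ?thesis by simp
  qed
  then show ?thesis
    unfolding exp_divdiff_residues by (subst sum.reindex[OF assms]) auto
qed

lemma exp_divdiff_tendsto:
  assumes lim: "\<And>i. i \<le> m \<Longrightarrow> ((\<lambda>k. y k i) \<longlongrightarrow> z i) F"
  shows "((\<lambda>k. exp_divdiff (y k) m) \<longlongrightarrow> exp_divdiff z m) F"
proof (cases "F = bot")
  case False
  define R where "R = 1 + (\<Sum>i\<le>m. norm (z i))"
  have less: "norm (z i) < R" if "i \<le> m" for i
    using norm_node_less[OF that] by (simp add: R_def)
  have R: "R > 0" using less[of 0] norm_ge_zero[of "z 0"] by linarith
  let ?K = "sphere (0::complex) R"
  let ?P = "\<lambda>y w. (\<Prod>i\<le>m. w - y i) :: complex"
  have ev: "\<forall>\<^sub>F k in F. \<forall>i\<in>{..m}. norm (y k i) < R"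
  proof (rule eventually_ball_finite)
    show "\<forall>i\<in>{..m}. \<forall>\<^sub>F k in F. norm (y k i) < R"
    proof
      fix i assume "i \<in> {..m}"
      then show "\<forall>\<^sub>F k in F. norm (y k i) < R"
        using order_tendstoD(2)[OF tendsto_norm[OF lim] less] by auto
    qed
  qed auto
  have path: "path_image (circlepath 0 R) = ?K" using R by simp
  have contour: "exp_divdiff v m =
      1 / (2 * of_real pi * \<i>) * contour_integral (circlepath 0 R) (\<lambda>w. exp w / ?P v w)"
    if "\<forall>i\<in>{..m}. norm (v i) < R" for v
  proof (rule exp_divdiff_contour)
    show "path_image (circlepath 0 R) \<inter> v ` {..m} = {}"
      using R that by fastforce
    show "winding_number (circlepath 0 R) (v i) = 1" if "i \<le> m" for i
      using \<open>\<forall>i\<in>{..m}. norm (v i) < R\<close> that by (intro winding_number_circlepath) auto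
  qed auto
  have bdd_prod: "bounded ((\<lambda>w. \<Prod>i\<in>A. w - z i) ` ?K)" for A :: "nat set"
    by (intro compact_imp_bounded compact_continuous_image continuous_intros) auto
  have "uniform_limit ?K (\<lambda>k w. \<Prod>i\<in>A. w - y k i) (\<lambda>w. \<Prod>i\<in>A. w - z i) F"
    if "finite A" "A \<subseteq> {..m}" for A
    using that
  proof (induction A rule: finite_induct)
    case (insert i A)
    have "uniform_limit ?K (\<lambda>k w. (w - y k i) * (\<Prod>i\<in>A. w - y k i))
            (\<lambda>w. (w - z i) * (\<Prod>i\<in>A. w - z i)) F"
    proof (rule uniform_lim_mult)
      have "((\<lambda>k. y k i) \<longlongrightarrow> z i) F" using lim insert.prems by auto
      then show "uniform_limit ?K (\<lambda>k w. w - y k i) (\<lambda>w. w - z i) F"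
        by (simp add: uniform_limit_iff tendsto_iff dist_norm norm_minus_commute)
      show "bounded ((\<lambda>w. w - z i) ` ?K)"
        by (intro compact_imp_bounded compact_continuous_image continuous_intros) auto
    qed (use insert bdd_prod in auto)
    then show ?case using insert by simp
  qed (auto intro: uniform_limit_const)
  then have ul: "uniform_limit ?K (\<lambda>k. ?P (y k)) (?P z) F" by auto
  have nz: "?P z w \<noteq> 0" if "w \<in> ?K" for w
    using that less by fastforce
  obtain b where b: "b > 0" "\<And>w. w \<in> ?K \<Longrightarrow> b \<le> norm (?P z w)"
  proof -
    have "\<exists>v\<in>?K. \<forall>w\<in>?K. norm (?P z v) \<le> norm (?P z w)"
      using R by (intro continuous_attains_inf continuous_intros) (auto simp: less_imp_le)
    then obtain v where v: "v \<in> ?K" "\<forall>w\<in>?K. norm (?P z v) \<le> norm (?P z w)" by blast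
    show ?thesis using that[of "norm (?P z v)"] v nz[of v] by auto
  qed
  have "uniform_limit ?K (\<lambda>k w. exp w / ?P (y k) w) (\<lambda>w. exp w / ?P z w) F"
  proof (rule uniform_lim_divide[OF uniform_limit_const ul _ b(2)])
    show "bounded ((exp :: complex \<Rightarrow> complex) ` ?K)"
      by (intro compact_imp_bounded compact_continuous_image continuous_intros) auto
  qed (use b in auto)
  moreover have "\<forall>\<^sub>F k in F. (\<lambda>w. exp w / ?P (y k) w) contour_integrable_on circlepath 0 R"
    using ev
  proof eventually_elim
    case (elim k)
    then have "?P (y k) w \<noteq> 0" if "w \<in> ?K" for w
      using that by fastforce
    then show ?case
      using R by (intro contour_integrable_continuous_circlepath continuous_intros) auto
  qed
  ultimately have "((\<lambda>k. contour_integral (circlepath 0 R) (\<lambda>w. exp w / ?P (y k) w)) \<longlongrightarrow>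
      contour_integral (circlepath 0 R) (\<lambda>w. exp w / ?P z w)) F"
    using False R by (intro contour_integral_uniform_limit_circlepath) auto
  then have "((\<lambda>k. 1 / (2 * of_real pi * \<i>) *
        contour_integral (circlepath 0 R) (\<lambda>w. exp w / ?P (y k) w)) \<longlongrightarrow> exp_divdiff z m) F"
    using less by (subst contour) (auto intro!: tendsto_intros)
  then show ?thesis
    by (rule Lim_transform_eventually) (use ev contour in \<open>auto elim: eventually_mono\<close>)
qed auto

lemma exp_divdiff_permute:
  assumes "p permutes {..m}"
  shows "exp_divdiff (z \<circ> p) m = exp_divdiff z m"
proof -
  have "(\<Sum>i\<le>m. norm ((z \<circ> p) i)) = (\<Sum>i\<le>m. norm (z i))"
    using sum.permute[OF assms, of "\<lambda>i. norm (z i)"] by (simp add: o_def)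
  moreover have "(\<Prod>i\<le>m. w - (z \<circ> p) i) = (\<Prod>i\<le>m. w - z i)" for w
    using prod.permute[OF assms, of "\<lambda>i. w - z i"] by (simp add: o_def)
  ultimately show ?thesis by (simp add: exp_divdiff_def)
qed

definition mean :: "(nat \<Rightarrow> real) \<Rightarrow> nat \<Rightarrow> real" where
  "mean x n = 1 / (real n + 1) * (\<Sum>i\<le>n. x i)"

definition variance :: "(nat \<Rightarrow> real) \<Rightarrow> nat \<Rightarrow> real" where
  "variance x n = 1 / (real n + 1) * (\<Sum>i\<le>n. (x i - mean x n)\<^sup>2)"

end

theory Submission
  imports Defs
begin

text \<open>
  Put \<open>y i = x i - \<mu>\<close> and expand \<open>1 / (\<Prod>i\<le>n. w - x i)\<close> in powers of \<open>1 / (w - \<mu>)\<close>. Integrating termwise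
  gives \<open>n! exp[x 0, \<dots>, x n] = exp \<mu> * (\<Sum>k. n! / (n + k)! * h k)\<close>, where \<open>h k\<close> is the complete
  homogeneous symmetric polynomial of degree \<open>k\<close> in the \<open>y i\<close>. The power sums satisfy \<open>p 1 = 0\<close> and
  \<open>\<bar>p j\<bar> \<le> s ^ j\<close> for \<open>j \<ge> 2\<close>, where \<open>s\<^sup>2 = p 2 = (n + 1) \<sigma>\<^sup>2\<close>, so Newton's identity
  \<open>k * h k = (\<Sum>j=1..k. p j * h (k - j))\<close> yields \<open>\<bar>h k\<bar> \<le> s ^ k\<close>. Hence the \<open>k\<close>-th term is at most
  \<open>q ^ k\<close> with \<open>q = s / (n + 1) = O(n powr (- 1 / 2))\<close>: the terms up to \<open>k = 2\<close> sum to
  \<open>1 + \<sigma>\<^sup>2 / (2 * (n + 2))\<close>, the rest is \<open>O(q ^ 3)\<close>, and taking logarithms gives the claim.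
\<close>

section \<open>Complete homogeneous symmetric polynomials and Newton's identity\<close>

definition geometric_fps :: "'a::field \<Rightarrow> 'a fps" where
  "geometric_fps c = Abs_fps (\<lambda>k. c ^ k)"

text \<open>For finite \<open>A\<close> this is the product of the series
  \<open>1 / (1 - y i * X)\<close>; its \<open>k\<close>-th coefficient is the complete homogeneous
  symmetric polynomial of degree \<open>k\<close>. As a product it suits induction over
  \<open>A\<close>, differentiation and evaluation.\<close>

definition complete_homogeneous_fps :: "('b \<Rightarrow> 'a::field) \<Rightarrow> 'b set \<Rightarrow> 'a fps" where
  "complete_homogeneous_fps y A = (\<Prod>i\<in>A. geometric_fps (y i))"

text \<open>With \<open>G = 1 / (1 - c * X)\<close> this is \<open>G' = c * G * G\<close>, bracketed
  so that the logarithmic derivative \<open>c * G\<close> stands as a separate factor.\<close>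

lemma fps_deriv_geometric_fps:
  "fps_deriv (geometric_fps c) = geometric_fps c * (fps_const c * geometric_fps c)"
proof (rule fps_ext)
  fix k
  have "(geometric_fps c * (fps_const c * geometric_fps c)) $ k = (\<Sum>i=0..k. c ^ i * (c * c ^ (k - i)))"
    by (subst fps_mult_nth) (simp add: geometric_fps_def)
  also have "\<dots> = (\<Sum>i=0..k. c ^ Suc k)"
    by (intro sum.cong) (auto simp: power_add[symmetric] power_Suc[symmetric] simp del: power_Suc)
  also have "\<dots> = fps_deriv (geometric_fps c) $ k"
    by (simp add: geometric_fps_def algebra_simps)
  finally show "fps_deriv (geometric_fps c) $ k = (geometric_fps c * (fps_const c * geometric_fps c)) $ k"
    by simp
qed

text \<open>Logarithmic derivatives of the factors add up. The \<open>m\<close>-th coefficient of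
  the resulting sum is the power sum of exponent \<open>m + 1\<close>, so comparing coefficients
  yields Newton's identity.\<close>

lemma fps_deriv_complete_homogeneous_fps:
  assumes "finite A"
  shows "fps_deriv (complete_homogeneous_fps y A) =
    complete_homogeneous_fps y A * (\<Sum>i\<in>A. fps_const (y i) * geometric_fps (y i))"
  using assms unfolding complete_homogeneous_fps_def
  by induction (simp_all add: fps_deriv_geometric_fps algebra_simps)

lemma complete_homogeneous_fps_nth_0 [simp]:
  "complete_homogeneous_fps y A $ 0 = 1"
  by (induction A rule: infinite_finite_induct)
    (simp_all add: complete_homogeneous_fps_def geometric_fps_def)

lemma complete_homogeneous_Newton:
  assumes "finite A"
  shows "of_nat (Suc k) * complete_homogeneous_fps y A $ Suc k =
    (\<Sum>j\<le>k. complete_homogeneous_fps y A $ j * (\<Sum>i\<in>A. y i ^ Suc (k - j)))"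
proof -
  have "of_nat (Suc k) * complete_homogeneous_fps y A $ Suc k = fps_deriv (complete_homogeneous_fps y A) $ k"
    by simp
  also have "\<dots> = (\<Sum>j\<le>k. complete_homogeneous_fps y A $ j * (\<Sum>i\<in>A. y i ^ Suc (k - j)))"
    unfolding fps_deriv_complete_homogeneous_fps[OF assms]
    by (subst fps_mult_nth) (simp add: fps_sum_nth geometric_fps_def atLeast0AtMost)
  finally show ?thesis .
qed

text \<open>Strong induction through Newton's identity: each of the \<open>k\<close> products is at
  most \<open>s ^ k\<close>, and the factor \<open>k\<close> on the left cancels their number. The
  bound therefore carries no combinatorial constant.\<close>

lemma norm_complete_homogeneous_le:
  fixes y :: "'b \<Rightarrow> 'a::real_normed_field"
  assumes "finite A" "0 \<le> s"
    and p1: "(\<Sum>i\<in>A. y i) = 0"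
    and p: "\<And>j. 2 \<le> j \<Longrightarrow> norm (\<Sum>i\<in>A. y i ^ j) \<le> s ^ j"
  shows "norm (complete_homogeneous_fps y A $ k) \<le> s ^ k"
proof (induction k rule: less_induct)
  case (less k)
  show ?case
  proof (cases k)
    case (Suc m)
    let ?h = "fps_nth (complete_homogeneous_fps y A)"
    have "real (Suc m) * norm (?h (Suc m)) = norm (of_nat (Suc m) * ?h (Suc m))"
      by (simp only: norm_mult norm_of_nat)
    also have "\<dots> \<le> (\<Sum>j\<le>m. norm (?h j * (\<Sum>i\<in>A. y i ^ Suc (m - j))))"
      unfolding complete_homogeneous_Newton[OF assms(1)] by (rule norm_sum)
    also have "\<dots> \<le> (\<Sum>j\<le>m. s ^ Suc m)"
    proof (rule sum_mono)
      fix j assume j: "j \<in> {..m}"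
      have "norm (\<Sum>i\<in>A. y i ^ Suc (m - j)) \<le> s ^ Suc (m - j)"
      \<comment> \<open>For \<open>j = m\<close> the power sum has exponent 1, where a bound by
        \<open>s\<close> could fail; it vanishes by \<open>p1\<close>.\<close>
      proof (cases "j = m")
        case True
        then show ?thesis using p1 \<open>0 \<le> s\<close> by simp
      next
        case False
        then show ?thesis using j by (intro p) auto
      qed
      moreover have "norm (?h j) \<le> s ^ j"
        using j Suc by (intro less) auto
      ultimately have "norm (?h j * (\<Sum>i\<in>A. y i ^ Suc (m - j))) \<le> s ^ j * s ^ Suc (m - j)"
        unfolding norm_mult using \<open>0 \<le> s\<close> by (intro mult_mono) auto
      also have "\<dots> = s ^ Suc m"
        using j by (simp only: power_add[symmetric]) auto
      finally show "norm (?h j * (\<Sum>i\<in>A. y i ^ Suc (m - j))) \<le> s ^ Suc m" .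
    qed
    also have "\<dots> = real (Suc m) * s ^ Suc m" by simp
    finally show ?thesis unfolding Suc using mult_le_cancel_left_pos[of "real (Suc m)"] by simp
  qed simp
qed

section \<open>Expansion of the reciprocal node polynomial in powers of \<open>1 / w\<close>\<close>

lemma fps_conv_radius_geometric_fps:
  fixes c w :: "'a::{real_normed_field,banach}"
  assumes "norm c < norm w"
  shows "ereal (norm (inverse w)) < fps_conv_radius (geometric_fps c)"
proof -
  \<comment> \<open>The reciprocal of the midpoint of \<open>norm c\<close> and
    \<open>norm w\<close>. It exceeds \<open>1 / norm w\<close> while \<open>norm c * r < 1\<close>,
    and it makes sense for \<open>c = 0\<close> too.\<close>
  define r where "r = 2 / (norm c + norm w)"
  have pos: "norm w > 0" using assms norm_ge_zero[of c] by linarith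
  have "r > 0" using pos by (auto simp: r_def intro!: divide_pos_pos add_nonneg_pos)
  have "norm (c * of_real r) = norm c * r"
    using \<open>r > 0\<close> by (simp add: norm_mult)
  also have "\<dots> < 1" using assms pos
    by (simp add: r_def field_simps add_nonneg_pos)
  finally have "summable (\<lambda>k. (c * of_real r) ^ k)" by (rule summable_geometric)
  then have "ereal (norm (of_real r :: 'a)) \<le> conv_radius (\<lambda>k. c ^ k)"
    by (intro conv_radius_geI) (simp add: power_mult_distrib)
  moreover have "norm (inverse w) < r"
  proof -
    have "norm (inverse w) = 1 / norm w"
      by (simp add: norm_divide inverse_eq_divide)
    also have "\<dots> < r" using assms pos by (simp add: r_def divide_simps add_nonneg_pos)
    finally show ?thesis .
  qed
  ultimately show ?thesis using \<open>r > 0\<close>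
    by (simp add: fps_conv_radius_def geometric_fps_def) (metis ereal_less_eq(3) less_le_trans less_ereal.simps(1))
qed

lemma eval_geometric_fps:
  fixes c :: "'a::{real_normed_field,banach}"
  assumes "norm c < norm w"
  shows "eval_fps (geometric_fps c) (inverse w) = w / (w - c)"
proof -
  have w: "w \<noteq> 0" "w \<noteq> c" using assms by auto
  have "eval_fps (geometric_fps c) (inverse w) = (\<Sum>k. (c * inverse w) ^ k)"
    by (simp add: eval_fps_def geometric_fps_def power_mult_distrib)
  also have "\<dots> = 1 / (1 - c * inverse w)"
    using assms w by (intro suminf_geometric) (simp add: norm_divide divide_inverse[symmetric])
  also have "\<dots> = w / (w - c)" using w by (simp add: field_simps)
  finally show ?thesis .
qed

text \<open>Radius and value are proved together, since evaluating the product in the induction step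
  requires the point to lie inside both discs of convergence.\<close>

lemma complete_homogeneous_fps_conv:
  fixes y :: "'b \<Rightarrow> 'a::{real_normed_field,banach}"
  assumes "finite A" "\<And>i. i \<in> A \<Longrightarrow> norm (y i) < norm w"
  shows "ereal (norm (inverse w)) < fps_conv_radius (complete_homogeneous_fps y A) \<and>
    eval_fps (complete_homogeneous_fps y A) (inverse w) = (\<Prod>i\<in>A. w / (w - y i))"
  using assms
proof (induction A rule: finite_induct)
  case empty
  then show ?case by (simp add: complete_homogeneous_fps_def)
next
  case (insert i A)
  have IH: "ereal (norm (inverse w)) < fps_conv_radius (complete_homogeneous_fps y A)"
    "eval_fps (complete_homogeneous_fps y A) (inverse w) = (\<Prod>i\<in>A. w / (w - y i))"
    using insert by auto
  have G: "ereal (norm (inverse w)) < fps_conv_radius (geometric_fps (y i))"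
    by (intro fps_conv_radius_geometric_fps insert) simp
  have eq: "complete_homogeneous_fps y (insert i A) = geometric_fps (y i) * complete_homogeneous_fps y A"
    using insert by (simp add: complete_homogeneous_fps_def)
  have "ereal (norm (inverse w)) < fps_conv_radius (geometric_fps (y i) * complete_homogeneous_fps y A)"
    using G IH(1) by (intro less_le_trans[OF _ fps_conv_radius_mult]) simp
  then show ?case unfolding eq
    using insert G IH by (simp add: eval_fps_mult eval_geometric_fps)
qed

lemma complete_homogeneous_sums:
  fixes y :: "'b \<Rightarrow> 'a::{real_normed_field,banach}"
  assumes "finite A" "\<And>i. i \<in> A \<Longrightarrow> norm (y i) < norm w"
  shows "(\<lambda>k. complete_homogeneous_fps y A $ k / w ^ (card A + k)) sums (1 / (\<Prod>i\<in>A. w - y i))"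
\<comment> \<open>For empty \<open>A\<close> the hypotheses allow \<open>w = 0\<close>, where
  inverse powers of \<open>w\<close> are useless; the series then has the single term 1.\<close>
proof (cases "A = {}")
  case True
  have "(\<lambda>k. if k = 0 then 1 else 0 :: 'a) sums 1" by (rule sums_single[of 0 "\<lambda>_. 1"])
  moreover have "(\<lambda>k. complete_homogeneous_fps y A $ k / w ^ (card A + k)) = (\<lambda>k. if k = 0 then 1 else 0)"
    using True by (auto simp: complete_homogeneous_fps_def)
  ultimately show ?thesis using True by simp
next
  case False
  then have w: "w \<noteq> 0" using assms(2) by force
  note conv = complete_homogeneous_fps_conv[OF assms]
  have "(\<lambda>k. complete_homogeneous_fps y A $ k * inverse w ^ k) sums (\<Prod>i\<in>A. w / (w - y i))"
    using sums_eval_fps[of "inverse w" "complete_homogeneous_fps y A"] conv by simp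
  then have "(\<lambda>k. inverse w ^ card A * (complete_homogeneous_fps y A $ k * inverse w ^ k)) sums
      (inverse w ^ card A * (\<Prod>i\<in>A. w / (w - y i)))"
    by (rule sums_mult)
  moreover have "inverse w ^ card A * (\<Prod>i\<in>A. w / (w - y i)) = 1 / (\<Prod>i\<in>A. w - y i)"
    using w by (simp add: prod_dividef field_simps)
  moreover have "inverse w ^ card A * (complete_homogeneous_fps y A $ k * inverse w ^ k) =
      complete_homogeneous_fps y A $ k / w ^ (card A + k)" for k
    by (simp add: power_add power_inverse field_simps)
  ultimately show ?thesis by simp
qed

section \<open>Series for the divided difference by termwise contour integration\<close>

lemma higher_deriv_exp: "(deriv ^^ k) exp = (exp :: complex \<Rightarrow> complex)"
proof (induction k)
  case (Suc k)
  have "deriv exp = (exp :: complex \<Rightarrow> complex)" by (intro ext DERIV_imp_deriv DERIV_exp)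
  then show ?case using Suc by simp
qed simp

text \<open>On a circle around \<open>c\<close> enclosing the nodes, the expansion of the integrand
  converges uniformly. Cauchy's formula for derivatives integrates each term.\<close>

lemma exp_divdiff_sums:
  fixes z :: "nat \<Rightarrow> complex" and c :: complex and n :: nat
  defines "h \<equiv> fps_nth (complete_homogeneous_fps (\<lambda>i. z i - c) {..n})"
  assumes s: "0 \<le> s" and z: "\<And>i. i \<le> n \<Longrightarrow> norm (z i - c) \<le> s"
    and h: "\<And>k. norm (h k) \<le> s ^ k"
  shows "(\<lambda>k. exp c * h k / fact (n + k)) sums exp_divdiff z n"
proof -
  define R where "R = s + 1"
  have R: "R > 0" "s < R" using s by (auto simp: R_def)
  let ?K = "sphere c R"
  let ?f = "\<lambda>k w. h k * (exp w / (w - c) ^ Suc (n + k))"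
  have wc: "norm (w - c) = R" if "w \<in> ?K" for w
    using that by (simp add: dist_norm norm_minus_commute)
  have path: "path_image (circlepath c R) = ?K" using R by simp
  have contour: "exp_divdiff z n =
      1 / (2 * of_real pi * \<i>) * contour_integral (circlepath c R) (\<lambda>w. exp w / (\<Prod>i\<le>n. w - z i))"
  proof (rule exp_divdiff_contour)
    have "z i \<notin> ?K" if "i \<le> n" for i
      using z[OF that] R wc[of "z i"] by auto
    then show "path_image (circlepath c R) \<inter> z ` {..n} = {}"
      unfolding path by auto
    show "winding_number (circlepath c R) (z i) = 1" if "i \<le> n" for i
      using z[OF that] R by (intro winding_number_circlepath) auto
  qed auto
  have sums: "(\<lambda>k. ?f k w) sums (exp w / (\<Prod>i\<le>n. w - z i))" if "w \<in> ?K" for w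
  proof -
    have "(\<lambda>k. h k / (w - c) ^ (card {..n} + k)) sums (1 / (\<Prod>i\<le>n. (w - c) - (z i - c)))"
      unfolding h_def
    proof (rule complete_homogeneous_sums)
      show "norm (z i - c) < norm (w - c)" if "i \<in> {..n}" for i
        using z[of i] that wc[OF \<open>w \<in> ?K\<close>] R by auto
    qed simp
    from sums_mult[OF this, of "exp w"] show ?thesis by (simp add: mult_ac)
  qed
  obtain B where B: "\<And>w. w \<in> ?K \<Longrightarrow> norm (exp w) \<le> B"
  proof -
    have "bounded ((exp :: complex \<Rightarrow> complex) ` ?K)"
      by (intro compact_imp_bounded compact_continuous_image continuous_intros) auto
    then show ?thesis using that unfolding bounded_iff by blast
  qed
  \<comment> \<open>On the circle \<open>exp\<close> is bounded by \<open>B\<close>, so the bound on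
    \<open>h k\<close> gives a geometric majorant of ratio \<open>s / R < 1\<close>.\<close>
  have "uniform_limit ?K (\<lambda>m w. \<Sum>k<m. ?f k w) (\<lambda>w. \<Sum>k. ?f k w) sequentially"
  proof (rule Weierstrass_m_test)
    fix k w assume w: "w \<in> ?K"
    have "norm (?f k w) = norm (h k) * norm (exp w) / R ^ Suc (n + k)"
      using wc[OF w] by (simp add: norm_mult norm_divide norm_power)
    also have "\<dots> \<le> s ^ k * B / R ^ Suc (n + k)"
      using h[of k] B[OF w] R s by (intro divide_right_mono mult_mono) auto
    also have "\<dots> = B / R ^ Suc n * (s / R) ^ k"
      by (simp add: power_add power_divide field_simps)
    finally show "norm (?f k w) \<le> B / R ^ Suc n * (s / R) ^ k" .
  next
    show "summable (\<lambda>k. B / R ^ Suc n * (s / R) ^ k)"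
      using R s by (intro summable_mult summable_geometric) auto
  qed
  then have ul: "uniform_limit ?K (\<lambda>m w. \<Sum>k<m. ?f k w) (\<lambda>w. exp w / (\<Prod>i\<le>n. w - z i)) sequentially"
    by (rule uniform_limit_cong'[THEN iffD1, rotated -1]) (use sums sums_unique in \<open>auto simp: sums_iff\<close>)
  \<comment> \<open>The \<open>n + 1\<close> nodes give the exponent \<open>Suc (n + k)\<close>,
    hence the derivative of order \<open>n + k\<close> and the factorial
    \<open>fact (n + k)\<close>.\<close>
  have summand: "(?f k has_contour_integral (2 * pi * \<i> * (exp c * h k / fact (n + k)))) (circlepath c R)" for k
  proof -
    have "((\<lambda>w. exp w / (w - c) ^ Suc (n + k)) has_contour_integral
        (2 * pi * \<i>) / fact (n + k) * (deriv ^^ (n + k)) exp c) (circlepath c R)"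
      using R by (intro Cauchy_has_contour_integral_higher_derivative_circlepath
        continuous_intros holomorphic_intros) auto
    from has_contour_integral_lmul[OF this, of "h k"] show ?thesis
      by (simp add: higher_deriv_exp mult_ac)
  qed
  have int: "((\<lambda>w. \<Sum>k<m. ?f k w) has_contour_integral
      (\<Sum>k<m. 2 * pi * \<i> * (exp c * h k / fact (n + k)))) (circlepath c R)" for m
    by (intro has_contour_integral_sum summand) auto
  have "((\<lambda>m. contour_integral (circlepath c R) (\<lambda>w. \<Sum>k<m. ?f k w)) \<longlongrightarrow>
      contour_integral (circlepath c R) (\<lambda>w. exp w / (\<Prod>i\<le>n. w - z i))) sequentially"
    using R by (intro contour_integral_uniform_limit_circlepath[OF _ ul] always_eventually allI
      has_contour_integral_integrable[OF int]) auto
  then have "(\<lambda>k. 2 * pi * \<i> * (exp c * h k / fact (n + k))) sums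
      contour_integral (circlepath c R) (\<lambda>w. exp w / (\<Prod>i\<le>n. w - z i))"
    unfolding sums_def using contour_integral_unique[OF int] by simp
  from sums_mult[OF this, of "1 / (2 * of_real pi * \<i>)"] show ?thesis
    unfolding contour by simp
qed

section \<open>Real nodes: power sums and the series up to second order\<close>

lemma complete_homogeneous_of_real:
  "complete_homogeneous_fps (\<lambda>i. of_real (y i) :: 'a::{real_normed_field}) A $ k =
    of_real (complete_homogeneous_fps y A $ k)"
proof (induction A arbitrary: k rule: infinite_finite_induct)
  case (insert i A)
  have eq: "complete_homogeneous_fps y (insert i A) = geometric_fps (y i) * complete_homogeneous_fps y A"
    and eq': "complete_homogeneous_fps (\<lambda>i. of_real (y i) :: 'a) (insert i A) =
      geometric_fps (of_real (y i)) * complete_homogeneous_fps (\<lambda>i. of_real (y i)) A"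
    using insert by (simp_all add: complete_homogeneous_fps_def)
  show ?case by (simp add: eq eq' fps_mult_nth insert.IH) (simp add: geometric_fps_def)
qed (simp_all add: complete_homogeneous_fps_def fps_one_def)

text \<open>Every \<open>\<bar>y i\<bar>\<close> is at most the root \<open>s\<close> of the sum of
  squares, so \<open>\<bar>y i\<bar> ^ j\<close> is at most
  \<open>s ^ (j - 2) * (y i)\<^sup>2\<close>; summing the squares restores the missing
  \<open>s\<^sup>2\<close>.\<close>

lemma abs_power_sum_le:
  fixes y :: "'b \<Rightarrow> real"
  assumes "finite A" "2 \<le> j"
  shows "\<bar>\<Sum>i\<in>A. y i ^ j\<bar> \<le> sqrt (\<Sum>i\<in>A. (y i)\<^sup>2) ^ j"
proof -
  let ?s = "sqrt (\<Sum>i\<in>A. (y i)\<^sup>2)"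
  have j: "j = (j - 2) + 2" using assms by simp
  have "\<bar>\<Sum>i\<in>A. y i ^ j\<bar> \<le> (\<Sum>i\<in>A. \<bar>y i ^ j\<bar>)" by (rule sum_abs)
  also have "\<dots> \<le> (\<Sum>i\<in>A. ?s ^ (j - 2) * (y i)\<^sup>2)"
  proof (rule sum_mono)
    fix i assume "i \<in> A"
    then have "\<bar>y i\<bar> \<le> ?s"
      using assms by (intro real_le_rsqrt) (auto intro: member_le_sum)
    then have "\<bar>y i\<bar> ^ (j - 2) * (y i)\<^sup>2 \<le> ?s ^ (j - 2) * (y i)\<^sup>2"
      by (intro mult_right_mono power_mono) auto
    also have "\<bar>y i\<bar> ^ (j - 2) * (y i)\<^sup>2 = \<bar>y i ^ j\<bar>"
    proof -
      have "\<bar>y i\<bar> ^ (j - 2) * \<bar>y i\<bar>\<^sup>2 = \<bar>y i\<bar> ^ j"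
        by (simp only: power_add[symmetric] j[symmetric])
      then show ?thesis by (simp add: power_abs)
    qed
    finally show "\<bar>y i ^ j\<bar> \<le> ?s ^ (j - 2) * (y i)\<^sup>2" .
  qed
  also have "\<dots> = ?s ^ (j - 2) * ?s\<^sup>2"
    by (simp add: sum_distrib_left[symmetric] sum_nonneg)
  also have "\<dots> = ?s ^ j" by (simp only: power_add[symmetric] j[symmetric])
  finally show ?thesis .
qed

text \<open>Each of the \<open>k\<close> extra factors \<open>n + 1, ..., n + k\<close> is at least
  \<open>n + 1\<close>. This turns the bound \<open>s ^ k\<close> into a power of
  \<open>s / (n + 1)\<close>.\<close>

lemma fact_mult_power_le: "fact n * (real n + 1) ^ k \<le> fact (n + k)"
proof (induction k)
  case (Suc k)
  have "fact n * (real n + 1) ^ Suc k = (real n + 1) * (fact n * (real n + 1) ^ k)" by simp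
  also have "\<dots> \<le> real (Suc (n + k)) * fact (n + k)"
    using Suc by (intro mult_mono) auto
  finally show ?case by simp
qed simp

lemma sum_deviation: "(\<Sum>i\<le>n. x i - mean x n) = 0"
proof -
  have "(real n + 1) * mean x n = (\<Sum>i\<le>n. x i)" by (simp add: mean_def)
  then show ?thesis by (simp add: sum_subtractf algebra_simps)
qed

lemma sum_deviation_squared: "(\<Sum>i\<le>n. (x i - mean x n)\<^sup>2) = (real n + 1) * variance x n"
  by (simp add: variance_def field_simps)

lemma variance_nonneg: "0 \<le> variance x n"
  by (simp add: variance_def sum_nonneg)

text \<open>Centring at the mean kills the linear term, and the quadratic term gives the variance
  correction. \<open>S\<close> is the sum of the normalised series; the terms from degree 3 on form
  a geometric tail in \<open>q n\<close>.\<close>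

lemma exp_divdiff_second_order:
  fixes x :: "nat \<Rightarrow> real"
  defines "q \<equiv> \<lambda>n. sqrt (variance x n / (real n + 1))"
  assumes q: "q n \<le> 1 / 2"
  obtains S :: real where
    "fact n * exp_divdiff (\<lambda>i. complex_of_real (x i)) n = complex_of_real (exp (mean x n) * S)"
    "\<bar>S - 1 - variance x n / (2 * (real n + 2))\<bar> \<le> 2 * q n ^ 3"
proof -
  define y where "y i = x i - mean x n" for i
  define s where "s = sqrt (\<Sum>i\<le>n. (y i)\<^sup>2)"
  define h where "h = fps_nth (complete_homogeneous_fps y {..n})"
  define T where "T k = h k * fact n / fact (n + k)" for k
  have p1: "(\<Sum>i\<le>n. y i) = 0" by (simp add: y_def sum_deviation)
  have p2: "(\<Sum>i\<le>n. (y i)\<^sup>2) = (real n + 1) * variance x n"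
    by (simp add: y_def sum_deviation_squared)
  have s: "0 \<le> s" "s\<^sup>2 = (real n + 1) * variance x n"
    by (simp_all add: s_def sum_nonneg p2 variance_nonneg)
  have sq: "s / (real n + 1) = q n"
  proof -
    have "q n = sqrt ((real n + 1) * variance x n / (real n + 1)\<^sup>2)"
      by (simp add: q_def power2_eq_square)
    then show ?thesis by (simp add: s_def p2 real_sqrt_divide)
  qed
  have q0: "0 \<le> q n" by (simp add: q_def variance_nonneg)
  have h_le: "\<bar>h k\<bar> \<le> s ^ k" for k
    unfolding h_def real_norm_def[symmetric]
    using p1 s(1) abs_power_sum_le[of "{..n}" _ y]
    by (intro norm_complete_homogeneous_le) (auto simp: s_def)
  have "h (Suc 0) = 0" using complete_homogeneous_Newton[of "{..n}" 0 y] p1 by (simp add: h_def)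
  \<comment> \<open>Newton's identity reads \<open>2 * h 2 = p 2 + h 1 * p 1\<close>, with
    \<open>p 1 = 0\<close> and \<open>p 2 = s\<^sup>2\<close>.\<close>
  moreover have "2 * h 2 = s\<^sup>2"
    using complete_homogeneous_Newton[of "{..n}" 1 y] p1 p2 s
    by (simp add: h_def numeral_2_eq_2)
  ultimately have h: "h 0 = 1" "h 1 = 0" "2 * h 2 = s\<^sup>2" by (simp_all add: h_def)
  have T_le: "\<bar>T k\<bar> \<le> q n ^ k" for k
  proof -
    have "\<bar>T k\<bar> = \<bar>h k\<bar> * (fact n / fact (n + k))" by (simp add: T_def abs_mult)
    also have "\<dots> \<le> s ^ k * (1 / (real n + 1) ^ k)"
      using h_le[of k] fact_mult_power_le[of n k] s
      by (intro mult_mono) (simp_all add: field_simps)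
    also have "\<dots> = q n ^ k" by (simp add: sq[symmetric] power_divide)
    finally show ?thesis .
  qed
  have geo: "summable (\<lambda>k. q n ^ k)" using q q0 by (intro summable_geometric) auto
  have T: "summable T" by (rule summable_comparison_test'[OF geo, of 0]) (use T_le in auto)
  have "(\<lambda>k. exp (complex_of_real (mean x n)) * of_real (h k) / fact (n + k)) sums
      exp_divdiff (\<lambda>i. complex_of_real (x i)) n"
  proof -
    have eq: "complex_of_real (x i) - complex_of_real (mean x n) = of_real (y i)" for i
      by (simp add: y_def)
    have y_le: "\<bar>y i\<bar> \<le> s" if "i \<le> n" for i
      unfolding s_def using that by (intro real_le_rsqrt) (auto intro: member_le_sum)
    show ?thesis
      using exp_divdiff_sums[of s n "\<lambda>i. complex_of_real (x i)" "complex_of_real (mean x n)"]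
      unfolding eq complete_homogeneous_of_real using s y_le h_le by (simp add: h_def)
  qed
  from sums_mult[OF this, of "fact n"]
  have "(\<lambda>k. complex_of_real (exp (mean x n) * T k)) sums
      (fact n * exp_divdiff (\<lambda>i. complex_of_real (x i)) n)"
    by (simp add: T_def exp_of_real mult_ac)
  moreover have "(\<lambda>k. complex_of_real (exp (mean x n) * T k)) sums of_real (exp (mean x n) * suminf T)"
    unfolding sums_of_real_iff by (intro sums_mult summable_sums T)
  ultimately have "fact n * exp_divdiff (\<lambda>i. complex_of_real (x i)) n = of_real (exp (mean x n) * suminf T)"
    by (rule sums_unique2)
  moreover have "\<bar>suminf T - 1 - variance x n / (2 * (real n + 2))\<bar> \<le> 2 * q n ^ 3"
  proof -
    \<comment> \<open>The factor \<open>n + 1\<close> in \<open>s\<^sup>2\<close> will cancel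
      against \<open>fact (n + 2) / fact n = (n + 1) * (n + 2)\<close>; hence \<open>n + 2\<close>
      in the denominator of the second-order term.\<close>
    have "T 2 = (2 * h 2) / (2 * (real n + 1) * (real n + 2))"
    proof -
      have "fact (n + 2) = fact n * ((real n + 1) * (real n + 2))"
        by (simp add: numeral_2_eq_2 algebra_simps)
      moreover have "2 * h 2 / (2 * (real n + 1) * (real n + 2)) = h 2 / ((real n + 1) * (real n + 2))"
        by (simp only: mult.assoc mult_divide_mult_cancel_left_if) simp
      ultimately show ?thesis by (simp only: T_def) simp
    qed
    also have "\<dots> = variance x n / (2 * (real n + 2))"
      by (simp only: h s mult.assoc mult.left_commute[of 2 "real n + 1"], subst mult_divide_mult_cancel_left) auto
    finally have T2: "T 2 = variance x n / (2 * (real n + 2))" .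
    have "suminf T - 1 - variance x n / (2 * (real n + 2)) = (\<Sum>k. T (k + 3))"
      using suminf_split_initial_segment[OF T, of 3] h T2
      by (simp add: numeral_3_eq_3 T_def numeral_2_eq_2)
    also have "\<bar>\<dots>\<bar> \<le> (\<Sum>k. q n ^ 3 * q n ^ k)"
      unfolding real_norm_def[symmetric]
      using T_le[of "_ + 3"] geo by (intro norm_suminf_le summable_mult) (simp_all add: power_add mult.commute)
    also have "\<dots> = q n ^ 3 * (1 / (1 - q n))"
      using q q0 geo by (simp add: suminf_mult suminf_geometric)
    \<comment> \<open>Here \<open>q n \<le> 1 / 2\<close> bounds \<open>1 / (1 - q n)\<close> by
      2.\<close>
    also have "\<dots> \<le> q n ^ 3 * 2"
      using q q0 by (intro mult_left_mono) (auto simp: field_simps)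
    finally show ?thesis by simp
  qed
  ultimately show thesis by (rule that)
qed

section \<open>Logarithms and the asymptotic formula\<close>

text \<open>With \<open>u = S - 1\<close> of size \<open>q\<^sup>2\<close>, replacing
  \<open>ln (1 + u)\<close> by \<open>u\<close> costs only order \<open>q ^ 4\<close>. The constant
  3 covers \<open>1 / 2\<close> from this and 2 from the error in \<open>S\<close>; \<open>d\<close>
  pays for exchanging the second-order term \<open>a\<close> for \<open>b\<close>.\<close>

lemma ln_perturbation_bound:
  fixes S a b q :: real
  assumes q: "0 \<le> q" "q \<le> 1 / 4" and a: "0 \<le> a" "a \<le> q\<^sup>2 / 2"
    and S: "\<bar>S - 1 - a\<bar> \<le> 2 * q ^ 3" and b: "\<bar>a - b\<bar> \<le> d"
  shows "S > 0" "\<bar>ln S - b\<bar> \<le> 3 * q ^ 3 + d"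
proof -
  define u where "u = S - 1"
  \<comment> \<open>This makes the error \<open>2 * q ^ 3\<close> at most
    \<open>q\<^sup>2 / 2\<close>, which together with the bound on \<open>a\<close> yields
    \<open>\<bar>u\<bar> \<le> q\<^sup>2\<close>.\<close>
  have q3: "q ^ 3 \<le> q\<^sup>2 / 4"
    using mult_left_mono[OF q(2), of "q\<^sup>2"] by (simp add: power3_eq_cube power2_eq_square)
  have q2: "q\<^sup>2 \<le> 1 / 16" using power_mono[OF q(2,1), of 2] by (simp add: power2_eq_square)
  have u: "\<bar>u\<bar> \<le> q\<^sup>2" using S a q3 by (auto simp: u_def)
  then show "S > 0" using q2 by (simp add: u_def)
  have "\<bar>ln (1 + u) - u\<bar> \<le> 2 * u\<^sup>2"
    using u q2 by (intro abs_ln_one_plus_x_minus_x_bound) auto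
  also have "u\<^sup>2 \<le> q\<^sup>2 * q\<^sup>2"
    using power_mono[OF u, of 2] by (simp add: power2_eq_square)
  also have "q\<^sup>2 * q\<^sup>2 = q ^ 3 * q" by (simp add: power3_eq_cube power2_eq_square)
  also have "\<dots> \<le> q ^ 3 * (1 / 4)" using q by (intro mult_left_mono) auto
  finally have "\<bar>ln S - u\<bar> \<le> q ^ 3 / 2" by (simp add: u_def)
  moreover have "0 \<le> q ^ 3" using q by simp
  ultimately show "\<bar>ln S - b\<bar> \<le> 3 * q ^ 3 + d"
    using S b unfolding u_def by linarith
qed

theorem corollary2:
  fixes x :: "nat \<Rightarrow> real" and C :: real
  assumes "\<And>n. variance x n \<le> C"
  shows "\<exists>r :: nat \<Rightarrow> real.
           r \<in> O(\<lambda>n. real n powr (- 3 / 2)) \<and>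
           (\<forall>\<^sub>F n in sequentially.
              fact n * exp_divdiff (\<lambda>i. complex_of_real (x i)) n =
              complex_of_real (exp (mean x n + variance x n / (2 * real n) + r n)))"
proof -
  define V where "V = variance x"
  define q where "q n = sqrt (V n / (real n + 1))" for n
  \<comment> \<open>The real part gives a real \<open>S n\<close> for every \<open>n\<close>. For
    the \<open>n\<close> treated in \<open>bound\<close> the divided difference is shown to be real,
    so nothing is lost there.\<close>
  define S where "S n = Re (fact n * exp_divdiff (\<lambda>i. complex_of_real (x i)) n) / exp (mean x n)" for n
  define r where "r n = ln (S n) - V n / (2 * real n)" for n
  have V: "0 \<le> V n" "V n \<le> C" for n
    using assms by (simp_all add: V_def variance_nonneg)
  then have C: "0 \<le> C" by (meson order_trans)
  have bound: "fact n * exp_divdiff (\<lambda>i. complex_of_real (x i)) n =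
        complex_of_real (exp (mean x n + V n / (2 * real n) + r n)) \<and>
      \<bar>r n\<bar> \<le> (3 * C powr (3 / 2) + C) * real n powr (- 3 / 2)"
    \<comment> \<open>The threshold \<open>16 * C\<close> forces
      \<open>(q n)\<^sup>2 \<le> 1 / 16\<close>, the smallness that the logarithm estimate asks
      for.\<close>
    if n: "n \<ge> 1" "16 * C \<le> real n" for n
  proof -
    have q: "0 \<le> q n" "(q n)\<^sup>2 = V n / (real n + 1)" using V by (simp_all add: q_def)
    have "q n \<le> sqrt (1 / 16)" unfolding q_def
      using V[of n] n by (intro real_sqrt_le_mono) (simp add: field_simps)
    then have q4: "q n \<le> 1 / 4" by (simp add: real_sqrt_divide)
    obtain S' where S': "fact n * exp_divdiff (\<lambda>i. complex_of_real (x i)) n =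
        complex_of_real (exp (mean x n) * S')"
      "\<bar>S' - 1 - V n / (2 * (real n + 2))\<bar> \<le> 2 * q n ^ 3"
      using exp_divdiff_second_order[of x n] q4 unfolding q_def V_def by auto
    have "S' = S n" unfolding S_def S' by simp
    note S = S'[unfolded this]
    \<comment> \<open>The series produces the denominator \<open>2 * (n + 2)\<close>, the claim has
      \<open>2 * n\<close>; exchanging them costs order \<open>1 / n\<^sup>2\<close>, below the
      allowed error.\<close>
    have diff: "\<bar>V n / (2 * (real n + 2)) - V n / (2 * real n)\<bar> \<le> C / (real n)\<^sup>2"
    proof -
      have "V n / (2 * (real n + 2)) - V n / (2 * real n) = - (V n / (real n * (real n + 2)))"
        using n by (simp add: divide_simps) (simp add: algebra_simps)
      moreover have "V n / (real n * (real n + 2)) \<le> C / (real n)\<^sup>2"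
        using V C n by (intro frac_le) (auto simp: power2_eq_square)
      ultimately show ?thesis using V[of n] by simp
    qed
    have "V n / (2 * (real n + 2)) \<le> (q n)\<^sup>2 / 2"
      using V[of n] unfolding q by (simp add: frac_le)
    note ln = ln_perturbation_bound[OF q(1) q4 _ this S(2) diff]
    have pos: "0 < S n" and r: "\<bar>r n\<bar> \<le> 3 * q n ^ 3 + C / (real n)\<^sup>2"
      using ln V[of n] by (auto simp: r_def)
    \<comment> \<open>The cubic tail determines the rate: \<open>q n\<close> is of order
      \<open>n powr (- 1 / 2)\<close>.\<close>
    have "q n ^ 3 \<le> sqrt (C / real n) ^ 3"
      unfolding q_def using V C n by (intro power_mono real_sqrt_le_mono frac_le) auto
    also have "\<dots> = (C / real n) powr (3 / 2)"
    proof (cases "C = 0")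
      case False
      then have pos: "0 < C / real n" using C n by simp
      then have "((C / real n) powr (1 / 2)) ^ 3 = (C / real n) powr (3 / 2)"
        using n by (subst powr_power) auto
      then show ?thesis using pos by (simp only: powr_half_sqrt[OF less_imp_le])
    qed simp
    also have "\<dots> = C powr (3 / 2) * real n powr (- 3 / 2)"
      using C powr_minus_divide[of "real n" "3 / 2"] by (simp add: powr_divide)
    finally have "3 * q n ^ 3 \<le> 3 * C powr (3 / 2) * real n powr (- 3 / 2)" by simp
    moreover have "C / (real n)\<^sup>2 \<le> C * real n powr (- 3 / 2)"
    proof -
      have "1 / (real n)\<^sup>2 = real n powr (- 2)"
        using n powr_minus_divide[of "real n" 2] by simp
      also have "\<dots> \<le> real n powr (- 3 / 2)" using n by (intro powr_mono) auto
      finally have "C * (1 / (real n)\<^sup>2) \<le> C * real n powr (- 3 / 2)" using C by (rule mult_left_mono)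
      then show ?thesis by simp
    qed
    moreover have "exp (mean x n) * S n = exp (mean x n + V n / (2 * real n) + r n)"
      using pos by (simp add: r_def exp_add)
    ultimately show ?thesis using r S(1) by (simp add: distrib_right)
  qed
  have ev: "\<forall>\<^sub>F n in sequentially. n \<ge> 1 \<and> 16 * C \<le> real n"
    using filterlim_real_sequentially unfolding filterlim_at_top
    by (intro eventually_conj eventually_ge_at_top) blast
  have "r \<in> O(\<lambda>n. real n powr (- 3 / 2))"
  proof (rule bigoI[of _ "3 * C powr (3 / 2) + C"], rule eventually_mono[OF ev])
    fix n assume "n \<ge> 1 \<and> 16 * C \<le> real n"
    then show "norm (r n) \<le> (3 * C powr (3 / 2) + C) * norm (real n powr (- 3 / 2))"
      using bound[of n] by simp
  qed
  moreover have "\<forall>\<^sub>F n in sequentially. fact n * exp_divdiff (\<lambda>i. complex_of_real (x i)) n =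
      complex_of_real (exp (mean x n + variance x n / (2 * real n) + r n))"
    by (rule eventually_mono[OF ev]) (use bound in \<open>simp only: V_def\<close>)
  ultimately show ?thesis by blast
qed

end
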